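(* If $f(z)=z+\sum_{n=2}^{\infty}a_nz^n\in \mathcal{S}_{S,L}^*$, then $$|H_{2,3}(f^{-1})-H_{2,3}(f)|\leq\frac{3}{64}.$$ The inequality is sharp for the function $g_1(z)=z+\frac14z^3+\cdots$ (that is, equality holds for $f=g_1$).
   Context: $\mathbb{D}=\{z\in\mathbb{C}:|z|<1\}$. $\mathcal{S}$ is the class of univalent (injective) analytic functions $f$ on $\mathbb{D}$ with expansion $f(z)=z+\sum_{n\ge 2}a_nz^n$. For analytic $g,h$ on $\mathbb{D}$, $g\prec h$ (subordination) means $g=h\circ w$ for some analytic $w:\mathbb{D}\to\mathbb{D}$ with $w(0)=0$. The class is $$\mathcal{S}_{S,L}^*=\left\{f\in\mathcal{S}:\ \frac{2zf'(z)}{f(z)-f(-z)}\prec \sqrt{1+z}\right\}$$ (principal branch of the square root). For $f\in\mathcal{S}$, the inverse function near $0$ is $f^{-1}(w)=w+A_2w^2+A_3w^3+A_4w^4+A_5w^5+\cdots$. Set $H_{2,3}(f):=a_3a_5-a_4^2$ and $H_{2,3}(f^{-1}):=A_3A_5-A_4^2$. The function $g_1\in\mathcal{S}_{S,L}^*$ is the one determined by $\frac{2zg_1'(z)}{g_1(z)-g_1(-z)}=\sqrt{1+z^2}$, $g_1(0)=g_1'(0)-1=0$. *)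

theory Defs
  imports "HOL-Complex_Analysis.Complex_Analysis"
begin

abbreviation unit_disc :: "complex set" where
  "unit_disc \<equiv> ball 0 1"

text \<open>
  Functions on the disc are modelled as total functions; only their values on the disc matter.
\<close>

definition class_S :: "(complex \<Rightarrow> complex) set" where
  "class_S = {f. f holomorphic_on unit_disc \<and> inj_on f unit_disc \<and> f 0 = 0 \<and> deriv f 0 = 1}"

definition subordinate :: "(complex \<Rightarrow> complex) \<Rightarrow> (complex \<Rightarrow> complex) \<Rightarrow> bool"
    (infix \<open>\<prec>\<^sub>s\<close> 50) where
  "g \<prec>\<^sub>s h \<longleftrightarrow> (\<exists>w. w holomorphic_on unit_disc \<and> w ` unit_disc \<subseteq> unit_disc \<and> w 0 = 0 \<and>
     (\<forall>z\<in>unit_disc. g z = h (w z)))"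

text \<open>
  The quotient \<open>2 z f'(z) / (f z - f (- z))\<close> is \<open>0 / 0\<close> at the origin. For \<open>f 0 = 0\<close>, \<open>f' 0 = 1\<close>
  this is a removable singularity with value \<open>1\<close>, which has to be filled in explicitly
  because division by zero yields \<open>0\<close> in HOL.
\<close>

definition sym_quot :: "(complex \<Rightarrow> complex) \<Rightarrow> complex \<Rightarrow> complex" where
  "sym_quot f z = (if z = 0 then 1 else 2 * z * deriv f z / (f z - f (- z)))"

definition class_SSL :: "(complex \<Rightarrow> complex) set" where
  "class_SSL = {f \<in> class_S. sym_quot f \<prec>\<^sub>s (\<lambda>z. csqrt (1 + z))}"

definition taylor_coeff :: "(complex \<Rightarrow> complex) \<Rightarrow> nat \<Rightarrow> complex" where
  "taylor_coeff f n = fps_nth (fps_expansion f 0) n"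

definition H23 :: "(complex \<Rightarrow> complex) \<Rightarrow> complex" where
  "H23 f = taylor_coeff f 3 * taylor_coeff f 5 - (taylor_coeff f 4)\<^sup>2"

text \<open>
  The inverse of \<open>f\<close> as a map from the disc onto its image. For \<open>f\<close> in \<open>class_S\<close> the image is
  an open neighbourhood of \<open>0\<close>, so the Taylor coefficients at \<open>0\<close> are those of the local inverse.
\<close>

definition disc_inverse :: "(complex \<Rightarrow> complex) \<Rightarrow> complex \<Rightarrow> complex" where
  "disc_inverse f = inv_into unit_disc f"

text \<open>
  This determines a function on the disc only; its values elsewhere are arbitrary.
  Membership in \<open>class_SSL\<close> is not assumed.
\<close>

definition is_g1 :: "(complex \<Rightarrow> complex) \<Rightarrow> bool" where
  "is_g1 g \<longleftrightarrow> g holomorphic_on unit_disc \<and> g 0 = 0 \<and> deriv g 0 = 1 \<and>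
     (\<forall>z\<in>unit_disc. sym_quot g z = csqrt (1 + z\<^sup>2))"

end

theory Submission
  imports Defs
begin

text \<open>
  Write \<open>2 z f'(z) / (f z - f (-z)) = sqrt (1 + w z)\<close> and let \<open>c\<^sub>k\<close> be the Taylor coefficients of \<open>w\<close>.
  With \<open>e = c\<^sub>2 - c\<^sub>1\<^sup>2 / 4 = 4 a\<^sub>3\<close> the difference of the two Hankel determinants, multiplied by \<open>64\<close>, equals
  \<open>- 3 e\<^sup>3 + 2 c\<^sub>1 e c\<^sub>3 - c\<^sub>1\<^sup>2 c\<^sub>4 + 3/4 c\<^sub>1\<^sup>3 c\<^sub>3 - 11/16 c\<^sub>1\<^sup>4 e + 3/64 c\<^sub>1\<^sup>6\<close>.
  The triangle inequality together with \<open>|c\<^sub>1|\<^sup>2 + ... + |c\<^sub>4|\<^sup>2 \<le> 1\<close> (Bessel's inequality on circles) bounds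
  this by \<open>3\<close>. The extremal function has the closed form \<open>2 z exp (s - 1) / (1 + s)\<close> with
  \<open>s = sqrt (1 + z\<^sup>2)\<close>.
\<close>

section \<open>The extremal inequality for the first four coefficients of \<open>w\<close>\<close>

text \<open>Here \<open>t\<close>, \<open>x\<close>, \<open>y\<close>, \<open>u\<close> stand for
  the moduli of \<open>c1\<close>, ..., \<open>c4\<close>, and \<open>E\<close> for that of
  \<open>e\<close>. With \<open>s\<close> the square of \<open>t\<close> and
  \<open>v = y\<^sup>2 + u\<^sup>2\<close>, the term \<open>3 * E^3\<close> stays below
  \<open>3\<close> by at least \<open>21/16 * s + 21/8 * v\<close>, and the remaining terms fit into
  this deficit.\<close>

lemma hankel_majorant_le_3:
  fixes t x y u E :: real
  assumes nn: "t \<ge> 0" "x \<ge> 0" "y \<ge> 0" "u \<ge> 0" "E \<ge> 0"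
    and sum: "t\<^sup>2 + x\<^sup>2 + y\<^sup>2 + u\<^sup>2 \<le> 1" and E: "E \<le> x + t\<^sup>2 / 4"
  shows "3 * E^3 + 2 * t * E * y + t\<^sup>2 * u + 3/4 * t^3 * y + 11/16 * t^4 * E + 3/64 * t^6 \<le> 3"
proof -
  define s where "s = t\<^sup>2"
  define v where "v = y\<^sup>2 + u\<^sup>2"
  define d where "d = s / 4 + v / 2"
  have s: "0 \<le> s" "s \<le> 1" "0 \<le> v" "v \<le> 1 - s"
    using sum by (auto simp: s_def v_def) (smt (verit) zero_le_power2)+
  have "0 \<le> (1 - x)\<^sup>2" by simp
  then have "2 * x \<le> 1 + x\<^sup>2" by (simp add: power2_eq_square algebra_simps)
  then have Ed: "E \<le> 1 - d"
    using E sum unfolding d_def v_def s_def by argo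
  have d: "0 \<le> d" "d \<le> 1/2" using s by (auto simp: d_def)
  have Es: "E \<le> 1 - s / 4" using Ed s by (auto simp: d_def)
  \<comment> \<open>On the interval from \<open>0\<close> to \<open>1/2\<close> the convex function
    \<open>(1 - d)^3\<close> lies below its chord \<open>1 - 7/4 * d\<close>; the product is the
    gap.\<close>
  have "0 \<le> d * ((1/2 - d) * (5/2 - d))"
    using d by (intro mult_nonneg_nonneg) auto
  moreover have "(1 - d)^3 = 1 - 7/4 * d - d * ((1/2 - d) * (5/2 - d))"
    by (simp add: power3_eq_cube field_simps)
  ultimately have "(1 - d)^3 \<le> 1 - 7/4 * d" by linarith
  moreover have "E^3 \<le> (1 - d)^3" using Ed nn by (intro power_mono) auto
  ultimately have A: "3 * E^3 \<le> 3 - 21/16 * s - 21/8 * v"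
    unfolding d_def by argo
  have "2 * t * E * y + 3/4 * t^3 * y = (t * y) * (2 * E + 3/4 * s)"
    by (simp add: s_def power3_eq_cube power2_eq_square algebra_simps)
  also have "\<dots> \<le> (t * y) * (9/4)"
    using Es s nn by (intro mult_left_mono) auto
  also have "\<dots> \<le> 21/8 * y\<^sup>2 + 1/2 * s"
  proof -
    \<comment> \<open>Completing the square spends the whole allowance \<open>21/8\<close> for
      \<open>y\<^sup>2\<close>, so that only a multiple of \<open>s\<close> is left over. The term
      with \<open>u\<close> is treated in the same way.\<close>
    have "21/8 * y\<^sup>2 + 1/2 * t\<^sup>2 - (t * y) * (9/4) = 21/8 * (y - 3/7 * t)\<^sup>2 + 1/56 * t\<^sup>2"
      by (simp add: power2_eq_square field_simps)
    moreover have "0 \<le> 21/8 * (y - 3/7 * t)\<^sup>2 + 1/56 * t\<^sup>2" by simp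
    ultimately show ?thesis unfolding s_def by linarith
  qed
  finally have B: "2 * t * E * y + 3/4 * t^3 * y \<le> 21/8 * y\<^sup>2 + 1/2 * s" .
  have C: "t\<^sup>2 * u \<le> 21/8 * u\<^sup>2 + 1/10 * s"
  proof -
    have "21/8 * u\<^sup>2 + 2/21 * s\<^sup>2 - s * u = 21/8 * (u - 4/21 * s)\<^sup>2"
      by (simp add: power2_eq_square field_simps)
    moreover have "0 \<le> 21/8 * (u - 4/21 * s)\<^sup>2" by simp
    moreover have "s\<^sup>2 \<le> s" using s by (simp add: power2_eq_square mult_left_le)
    ultimately show ?thesis using s unfolding s_def[symmetric] by linarith
  qed
  have s2: "t^4 = s\<^sup>2" "t^6 = s^3" by (simp_all add: s_def flip: power_mult)
  have "t^4 * E \<le> s\<^sup>2 * (1 - s/4)"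
    unfolding s2 by (intro mult_left_mono Es) auto
  also have "\<dots> \<le> 3/4 * s"
  proof -
    have "0 \<le> s * ((1 - s) * (3/4 - s / 4))" using s by (intro mult_nonneg_nonneg) auto
    moreover have "3/4 * s - s\<^sup>2 * (1 - s/4) = s * ((1 - s) * (3/4 - s / 4))"
      by (simp add: power2_eq_square field_simps)
    ultimately show ?thesis by linarith
  qed
  finally have D: "11/16 * t^4 * E \<le> 33/64 * s" by linarith
  have F: "3/64 * t^6 \<le> 3/64 * s"
    unfolding s2 using s by (simp add: power3_eq_cube mult_left_le mult_le_one)
  \<comment> \<open>The multiples of \<open>s\<close> add up to
    \<open>1/2 + 1/10 + 33/64 + 3/64 = 93/80\<close>, which is below the available
    \<open>21/16\<close>.\<close>
  show ?thesis using A B C D F s unfolding v_def by argo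
qed

text \<open>Using \<open>e\<close> in place of \<open>c2\<close> leaves \<open>e^3\<close> as the
  only term without a factor \<open>c1\<close>. This is why the extremal case has
  \<open>c1 = 0\<close>.\<close>

lemma hankel_difference_identity:
  fixes c1 c2 c3 c4 a2 a3 a4 a5 A3 A4 A5 :: complex
  assumes "c1 = 4 * a2" "c2 = 4 * a3 + 4 * a2\<^sup>2" "c3 = 8 * a4 + 4 * a2 * a3"
    "c4 = 8 * a5 + 16 * a2 * a4 - 8 * a2\<^sup>2 * a3"
    "A3 = 2*a2\<^sup>2 - a3" "A4 = -5*a2^3 + 5*a2*a3 - a4"
    "A5 = 14*a2^4 - 21*a2\<^sup>2*a3 + 6*a2*a4 + 3*a3\<^sup>2 - a5" "e = c2 - c1\<^sup>2/4"
  shows "64 * ((A3*A5 - A4\<^sup>2) - (a3*a5 - a4\<^sup>2)) =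
    - (3 * e^3) + 2*c1*e*c3 - c1\<^sup>2*c4 + 3/4*c1^3*c3 - 11/16*c1^4*e + 3/64*c1^6"
proof -
  have e: "e = 4 * a3" using assms by (simp add: power_mult_distrib)
  show ?thesis
    unfolding e unfolding assms by (simp add: power_mult_distrib) algebra
qed

lemma norm_hankel_difference_le_3:
  fixes c1 c2 c3 c4 e :: complex
  assumes "(cmod c1)\<^sup>2 + (cmod c2)\<^sup>2 + (cmod c3)\<^sup>2 + (cmod c4)\<^sup>2 \<le> 1" and e: "e = c2 - c1\<^sup>2/4"
  shows "cmod (- (3 * e^3) + 2*c1*e*c3 - c1\<^sup>2*c4 + 3/4*c1^3*c3 - 11/16*c1^4*e + 3/64*c1^6) \<le> 3"
proof -
  have "cmod e \<le> cmod c2 + (cmod c1)\<^sup>2 / 4"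
    unfolding e by (rule order_trans[OF norm_triangle_ineq4]) (simp add: norm_mult norm_power norm_divide)
  from hankel_majorant_le_3[OF _ _ _ _ _ assms(1) this]
  have "3 * cmod e^3 + 2 * cmod c1 * cmod e * cmod c3 + (cmod c1)\<^sup>2 * cmod c4 + 3/4 * cmod c1^3 * cmod c3
     + 11/16 * cmod c1^4 * cmod e + 3/64 * cmod c1^6 \<le> 3" by simp
  moreover have "cmod (- (3 * e^3) + 2*c1*e*c3 - c1\<^sup>2*c4 + 3/4*c1^3*c3 - 11/16*c1^4*e + 3/64*c1^6)
    \<le> cmod (- (3 * e^3)) + cmod (2*c1*e*c3) + cmod (c1\<^sup>2*c4) + cmod (3/4*c1^3*c3) + cmod (11/16*c1^4*e) + cmod (3/64*c1^6)"
    by (intro norm_triangle_le norm_triangle_le_diff add_mono order_refl)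
  ultimately show ?thesis by (simp add: norm_mult norm_power norm_divide)
qed

section \<open>Taylor coefficients of the inverse function\<close>

text \<open>The expansions of \<open>f\<close> and of its inverse compose to \<open>fps_X\<close>.
  Since \<open>b 1 = 1\<close>, the coefficient of order \<open>n\<close> of the composition
  contains \<open>B n\<close> with factor \<open>1\<close> and otherwise only earlier
  \<open>B k\<close>, so the equations are solved one after the other.\<close>

lemma inverse_coeffs:
  assumes "f \<in> class_S"
  defines "a \<equiv> taylor_coeff f" and "A \<equiv> taylor_coeff (disc_inverse f)"
  shows "A 3 = 2 * (a 2)\<^sup>2 - a 3"
    and "A 4 = -5 * a 2 ^ 3 + 5 * a 2 * a 3 - a 4"
    and "A 5 = 14 * a 2 ^ 4 - 21 * (a 2)\<^sup>2 * a 3 + 6 * a 2 * a 4 + 3 * (a 3)\<^sup>2 - a 5"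
proof -
  have hol: "f holomorphic_on unit_disc" and inj: "inj_on f unit_disc"
    and f0: "f 0 = 0" and f1: "deriv f 0 = 1"
    using assms(1) by (auto simp: class_S_def)
  obtain h where h: "h holomorphic_on f ` unit_disc" "\<And>z. z \<in> unit_disc \<Longrightarrow> h (f z) = z"
    using holomorphic_has_inverse[OF hol open_ball inj] by metis
  have inv: "disc_inverse f (f z) = z" if "z \<in> unit_disc" for z
    unfolding disc_inverse_def using inj that by simp
  have "open (f ` unit_disc)"
    by (rule open_mapping_thm3[OF hol open_ball inj])
  \<comment> \<open>Injectivity makes \<open>inv_into\<close> coincide on the image with the
    holomorphic inverse \<open>h\<close>, from which it inherits holomorphy.\<close>
  moreover have "disc_inverse f holomorphic_on f ` unit_disc"
    using h by (subst holomorphic_cong[OF refl, of _ _ h]) (auto simp: inv simp del: mem_ball)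
  moreover have "0 \<in> f ` unit_disc"
    using f0 by (force simp: image_iff)
  ultimately have G: "disc_inverse f has_fps_expansion fps_expansion (disc_inverse f) 0"
    by blast
  have F: "f has_fps_expansion fps_expansion f 0"
    using hol by (intro has_fps_expansion_fps_expansion[OF open_ball]) auto
  define p where "p = fps_expansion f 0"
  define q where "q = fps_expansion (disc_inverse f) 0"
  define b where "b = fps_nth p"
  define B where "B = fps_nth q"
  have b01: "b 0 = 0" "b (Suc 0) = 1" by (simp_all add: b_def p_def fps_expansion_def f0 f1)
  have "(disc_inverse f \<circ> f) has_fps_expansion (q oo p)"
    using has_fps_expansion_compose[OF G F] b01 by (simp add: b_def p_def q_def)
  moreover have "\<forall>\<^sub>F z in nhds 0. (disc_inverse f \<circ> f) z = z"
    using eventually_nhds_in_open[of unit_disc 0] by (auto elim!: eventually_mono simp: inv)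
  ultimately have "(\<lambda>z. z) has_fps_expansion (q oo p)"
    by (simp cong: has_fps_expansion_cong)
  then have "q oo p = fps_X"
    using fps_expansion_unique_complex has_fps_expansion_fps_X by blast
  then have eq: "fps_nth (q oo p) n = fps_nth fps_X n" for n by simp
  have a: "a n = b n" "A n = B n" for n
    by (simp_all add: a_def A_def taylor_coeff_def p_def q_def b_def B_def)
  note S = fps_compose_nth fps_mult_nth eval_nat_numeral b01 b_def[symmetric] B_def[symmetric]
  have q0: "B 0 = 0" using eq[of 0] by (simp add: S)
  have q1: "B (Suc 0) = 1" using eq[of 1] by (simp add: S q0)
  have "b 2 + B 2 = 0" using eq[of 2] by (simp add: S q0 q1)
  then have q2: "B 2 = - b 2" by (simp only: eq_neg_iff_add_eq_0 add.commute)
  have "b 3 + 2 * B 2 * b 2 + B 3 = 0"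
    using eq[of 3] by (simp add: S q0 q1 algebra_simps)
  then have "B 3 = - (b 3 + 2 * B 2 * b 2)" by (simp only: eq_neg_iff_add_eq_0 add.commute)
  then have q3: "B 3 = 2 * (b 2)\<^sup>2 - b 3"
    unfolding q2 by (simp add: power2_eq_square)
  have "b 4 + B 2 * (2 * b 3 + b 2 * b 2) + 3 * B 3 * b 2 + B 4 = 0"
    using eq[of 4] by (simp add: S q0 q1 algebra_simps)
  then have "B 4 = - (b 4 + B 2 * (2 * b 3 + b 2 * b 2) + 3 * B 3 * b 2)"
    by (simp only: eq_neg_iff_add_eq_0 add.commute)
  then have q4: "B 4 = -5 * b 2 ^ 3 + 5 * b 2 * b 3 - b 4"
    unfolding q2 q3 by (simp add: algebra_simps power2_eq_square power3_eq_cube)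
  have "b 5 + B 2 * (2 * b 4 + 2 * b 2 * b 3) + B 3 * (3 * b 3 + 3 * b 2 * b 2) + 4 * B 4 * b 2 + B 5 = 0"
    using eq[of 5] by (simp add: S q0 q1 algebra_simps)
  then have "B 5 = - (b 5 + B 2 * (2 * b 4 + 2 * b 2 * b 3) + B 3 * (3 * b 3 + 3 * b 2 * b 2) + 4 * B 4 * b 2)"
    by (simp only: eq_neg_iff_add_eq_0 add.commute)
  then have q5: "B 5 = 14 * b 2 ^ 4 - 21 * (b 2)\<^sup>2 * b 3 + 6 * b 2 * b 4 + 3 * (b 3)\<^sup>2 - b 5"
    unfolding q2 q3 q4 by (simp add: algebra_simps power2_eq_square power3_eq_cube power4_eq_xxxx)
  show "A 3 = 2 * (a 2)\<^sup>2 - a 3" "A 4 = -5 * a 2 ^ 3 + 5 * a 2 * a 3 - a 4"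
    "A 5 = 14 * a 2 ^ 4 - 21 * (a 2)\<^sup>2 * a 3 + 6 * a 2 * a 4 + 3 * (a 3)\<^sup>2 - a 5"
    unfolding a by (fact q3 q4 q5)+
qed

section \<open>Bessel's inequality for bounded functions on the disc\<close>

lemma taylor_coeff_eqI: "f has_fps_expansion F \<Longrightarrow> taylor_coeff f n = fps_nth F n"
  by (simp add: taylor_coeff_def fps_expansion_eqI)

text \<open>Cauchy's formula for the derivative of order \<open>k\<close>, parametrised by the
  angle: the Taylor coefficient becomes a Fourier coefficient.\<close>

lemma circle_coeff_has_integral:
  assumes "f holomorphic_on ball 0 R" "0 < r" "r < R"
  shows "((\<lambda>t. f (r * cis t) * cis (- (real k * t))) has_integral
    2 * pi * r ^ k * taylor_coeff f k) {0..2*pi}"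
proof -
  have "continuous_on (cball 0 r) f" "f holomorphic_on ball 0 r"
    using assms by (auto intro!: holomorphic_on_imp_continuous_on intro: holomorphic_on_subset)
  from Cauchy_has_contour_integral_higher_derivative_circlepath[OF this, of 0 k]
  have "((\<lambda>u. f u / u ^ Suc k) has_contour_integral 2 * pi * \<i> * taylor_coeff f k) (circlepath 0 r)"
    using assms by (simp add: taylor_coeff_def fps_expansion_def)
  then have "((\<lambda>t. f (r * cis t) / (r * cis t) ^ Suc k * r * \<i> * cis t) has_integral
      2 * pi * \<i> * taylor_coeff f k) {0..2*pi}"
    unfolding circlepath_def
    by (subst (asm) has_contour_integral_part_circlepath_iff) auto
  then have "((\<lambda>t. f (r * cis t) / (r * cis t) ^ Suc k * r * \<i> * cis t * (r ^ k / \<i>)) has_integral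
      2 * pi * \<i> * taylor_coeff f k * (r ^ k / \<i>)) {0..2*pi}"
    by (rule has_integral_mult_left)
  moreover have "f (r * cis t) / (r * cis t) ^ Suc k * r * \<i> * cis t * (r ^ k / \<i>)
      = f (r * cis t) * cis (- (real k * t))" for t
  proof -
    have "cis (- (real k * t)) = 1 / cis t ^ k"
      by (metis Complex.DeMoivre cis_inverse inverse_eq_divide)
    then show ?thesis
      using assms by (simp add: power_mult_distrib field_simps)
  qed
  ultimately show ?thesis by (simp add: mult_ac)
qed

text \<open>Let \<open>P\<close> be the Taylor polynomial of degree \<open>n\<close>. Expanding the
  square of \<open>cmod (f - P)\<close> gives \<open>Re (2 * f * cnj P - P * cnj P) \<le> 1\<close>
  on the circle, because \<open>cmod f \<le> 1\<close>. The left side integrates to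
  \<open>2 * pi * S\<close>, since \<open>f\<close> and \<open>P\<close> have the same inner product
  with \<open>P\<close>.\<close>

lemma bessel_circle:
  assumes hol: "f holomorphic_on unit_disc" and bd: "\<And>z. z \<in> unit_disc \<Longrightarrow> cmod (f z) \<le> 1"
    and r: "0 < r" "r < 1"
  shows "(\<Sum>k\<le>n. (cmod (taylor_coeff f k))\<^sup>2 * r ^ (2 * k)) \<le> 1"
proof -
  define c where "c = taylor_coeff f"
  define S where "S = (\<Sum>k\<le>n. (cmod (c k))\<^sup>2 * r ^ (2 * k))"
  define P where "P = (\<lambda>z. \<Sum>k\<le>n. c k * z ^ k)"
  define q where "q = (\<lambda>t::real. \<Sum>k\<le>n. cnj (c k) * r ^ k * cis (- (real k * t)))"
  have P: "P holomorphic_on unit_disc"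
    unfolding P_def by (intro holomorphic_intros)
  have "P has_fps_expansion (\<Sum>k\<le>n. fps_const (c k) * fps_X ^ k)"
    unfolding P_def by (intro fps_expansion_intros)
  then have Pc: "taylor_coeff P k = c k" if "k \<le> n" for k
    using that by (simp add: taylor_coeff_eqI fps_sum_nth if_distrib sum.delta cong: if_cong)
  have q_cnj: "q t = cnj (P (r * cis t))" for t
    unfolding q_def P_def
    by (simp add: power_mult_distrib cis_cnj Complex.DeMoivre mult_ac)
  \<comment> \<open>Only the frequencies up to \<open>n\<close> occur in \<open>q\<close>, so the
    integral sees no other coefficients of \<open>g\<close>; the claim then serves for both
    \<open>f\<close> and \<open>P\<close>.\<close>
  have int: "((\<lambda>t. g (r * cis t) * q t) has_integral 2 * pi * S) {0..2*pi}"
    if g: "g holomorphic_on unit_disc" and gc: "\<And>k. k \<le> n \<Longrightarrow> taylor_coeff g k = c k" for g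
  proof -
    have "((\<lambda>t. \<Sum>k\<le>n. cnj (c k) * r ^ k * (g (r * cis t) * cis (- (real k * t)))) has_integral
        (\<Sum>k\<le>n. cnj (c k) * r ^ k * (2 * pi * r ^ k * taylor_coeff g k))) {0..2*pi}"
      by (intro has_integral_sum has_integral_mult_right circle_coeff_has_integral[OF g] r) auto
    moreover have "of_real (cmod (c k)) * of_real (cmod (c k)) = c k * cnj (c k)" for k
      by (metis complex_norm_square power2_eq_square of_real_mult)
    then have "(\<Sum>k\<le>n. cnj (c k) * r ^ k * (2 * pi * r ^ k * taylor_coeff g k)) = 2 * pi * S"
      unfolding S_def of_real_mult of_real_sum sum_distrib_left
      by (intro sum.cong refl)
         (simp add: gc power_mult power2_eq_square power_mult_distrib mult_ac)
    ultimately show ?thesis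
      unfolding q_def by (simp add: sum_distrib_left mult_ac)
  qed
  have "((\<lambda>t. 2 * (f (r * cis t) * q t) - P (r * cis t) * q t) has_integral
      2 * complex_of_real (2 * pi * S) - complex_of_real (2 * pi * S)) {0..2*pi}"
    by (intro has_integral_diff has_integral_mult_right int hol P) (auto simp: Pc c_def)
  from has_integral_Re[OF this]
  have I: "((\<lambda>t. Re (2 * (f (r * cis t) * q t) - P (r * cis t) * q t)) has_integral 2 * pi * S) {0..2*pi}"
    by (simp add: mult_ac)
  have I1: "((\<lambda>t. 1) has_integral 2 * pi) {0..2*pi}"
    using has_integral_const_real[of "1::real" 0 "2*pi"] by simp
  have "Re (2 * (f (r * cis t) * q t) - P (r * cis t) * q t) \<le> 1" for t
  proof -
    define u v where "u = f (r * cis t)" and "v = P (r * cis t)"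
    have "cmod u \<le> 1" unfolding u_def using r by (intro bd) (auto simp: norm_mult)
    then have "(cmod u)\<^sup>2 \<le> 1" by (simp add: power_le_one)
    moreover have "0 \<le> (cmod (u - v))\<^sup>2" by simp
    moreover have "(cmod (u - v))\<^sup>2 = (cmod u)\<^sup>2 - Re (2 * (u * cnj v) - v * cnj v)"
      unfolding cmod_power2 by (simp add: power2_eq_square algebra_simps)
    ultimately show ?thesis unfolding q_cnj u_def[symmetric] v_def[symmetric] by linarith
  qed
  then have "2 * pi * S \<le> 2 * pi" by (rule has_integral_le[OF I I1])
  then have "S \<le> 1" by simp
  then show ?thesis by (simp add: S_def c_def)
qed

text \<open>The finite sum is continuous in the radius, which may therefore tend to \<open>1\<close>
  from below.\<close>

lemma bessel_unit_disc:
  assumes hol: "f holomorphic_on unit_disc" and bd: "\<And>z. z \<in> unit_disc \<Longrightarrow> cmod (f z) \<le> 1"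
  shows "(\<Sum>k\<le>n. (cmod (taylor_coeff f k))\<^sup>2) \<le> 1"
proof (rule tendsto_upperbound)
  show "((\<lambda>r::real. \<Sum>k\<le>n. (cmod (taylor_coeff f k))\<^sup>2 * r ^ (2 * k)) \<longlongrightarrow>
      (\<Sum>k\<le>n. (cmod (taylor_coeff f k))\<^sup>2)) (at_left 1)"
    by (auto intro!: tendsto_eq_intros)
  have "eventually (\<lambda>r::real. r \<in> {0<..<1}) (at_left 1)"
    by (intro eventually_at_leftI[of 0]) auto
  then show "\<forall>\<^sub>F r in at_left 1. (\<Sum>k\<le>n. (cmod (taylor_coeff f k))\<^sup>2 * r ^ (2 * k)) \<le> 1"
    by eventually_elim (auto intro: bessel_circle[OF hol bd])
qed auto

section \<open>Coefficients of \<open>w\<close> in terms of those of \<open>f\<close>\<close>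

lemma csqrt_unit_disc:
  assumes "w \<in> unit_disc"
  shows "1 + w \<notin> \<real>\<^sub>\<le>\<^sub>0" and "csqrt (1 + w) \<noteq> 0" and "0 < Re (csqrt (1 + w))"
proof -
  have "0 < Re (1 + w)"
    using assms abs_Re_le_cmod[of w] by simp
  then show 1: "1 + w \<notin> \<real>\<^sub>\<le>\<^sub>0" by (auto simp: complex_nonpos_Reals_iff)
  then show "csqrt (1 + w) \<noteq> 0" by (metis csqrt_eq_0 nonpos_Reals_zero_I)
  \<comment> \<open>\<open>Re (u\<^sup>2) > 0\<close> excludes a purely imaginary \<open>u\<close>,
    and the principal branch has nonnegative real part.\<close>
  define u where "u = csqrt (1 + w)"
  have "Re (1 + w) = Re (u\<^sup>2)" by (simp add: u_def)
  also have "\<dots> = (Re u)\<^sup>2 - (Im u)\<^sup>2" by (rule Re_power2)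
  finally have "Re u \<noteq> 0" using \<open>0 < Re (1 + w)\<close> by (auto simp: not_less[symmetric])
  moreover have "0 \<le> Re u" using csqrt_principal[of "1 + w"] by (auto simp: u_def simp del: csqrt.sel)
  ultimately show "0 < Re (csqrt (1 + w))" by (simp add: u_def del: csqrt.sel)
qed

text \<open>Two power series identities are compared: clearing the denominator expresses the
  coefficients of \<open>s = sqrt (1 + w)\<close> by those of \<open>f\<close>, and squaring
  \<open>s\<close> then gives those of \<open>w\<close>.\<close>

lemma sym_quot_coeffs:
  assumes f: "f holomorphic_on unit_disc" "f 0 = 0" "deriv f 0 = 1"
    and w: "w holomorphic_on unit_disc" "w ` unit_disc \<subseteq> unit_disc" "w 0 = 0"
    and fw: "\<And>z. z \<in> unit_disc \<Longrightarrow> sym_quot f z = csqrt (1 + w z)"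
  defines "a \<equiv> taylor_coeff f" and "c \<equiv> taylor_coeff w"
  shows "c 1 = 4 * a 2" and "c 2 = 4 * a 3 + 4 * (a 2)\<^sup>2" and "c 3 = 8 * a 4 + 4 * a 2 * a 3"
    and "c 4 = 8 * a 5 + 16 * a 2 * a 4 - 8 * (a 2)\<^sup>2 * a 3"
proof -
  define s where "s = (\<lambda>z. csqrt (1 + w z))"
  have s: "s holomorphic_on unit_disc"
    unfolding s_def using w(1,2) by (intro holomorphic_intros csqrt_unit_disc(1)) (auto simp: image_subset_iff)
  define F W Q where "F = fps_expansion f 0" and "W = fps_expansion w 0" and "Q = fps_expansion s 0"
  have F: "f has_fps_expansion F" and W: "w has_fps_expansion W" and Q: "s has_fps_expansion Q"
    unfolding F_def W_def Q_def using f(1) w(1) s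
    by (auto intro!: has_fps_expansion_fps_expansion[OF open_ball])
  have "(\<lambda>z. s z ^ 2) has_fps_expansion Q ^ 2"
    by (intro fps_expansion_intros Q)
  moreover have "(\<lambda>z. s z ^ 2) = (\<lambda>z. 1 + w z)" by (simp add: s_def)
  moreover have "(\<lambda>z. 1 + w z) has_fps_expansion 1 + W"
    by (intro fps_expansion_intros W)
  ultimately have QW: "Q ^ 2 = 1 + W"
    using fps_expansion_unique_complex by metis
  have "(\<lambda>z. -1 * z) has_fps_expansion (fps_const (-1) * fps_X :: complex fps)"
    by (intro fps_expansion_intros)
  then have "(f \<circ> (\<lambda>z. -1 * z)) has_fps_expansion (F oo (fps_const (-1) * fps_X))"
    by (rule has_fps_expansion_compose[OF F]) simp
  then have L: "(\<lambda>z. (f z - (f \<circ> (\<lambda>z. -1 * z)) z) * s z) has_fps_expansion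
      (F - (F oo (fps_const (-1) * fps_X))) * Q"
    by (intro has_fps_expansion_mult has_fps_expansion_diff F Q)
  have R: "(\<lambda>z. 2 * (z * deriv f z)) has_fps_expansion 2 * (fps_X * fps_deriv F)"
    by (intro fps_expansion_intros F)
  have "\<forall>\<^sub>F z in nhds 0. (f z - (f \<circ> (\<lambda>z. -1 * z)) z) * s z = 2 * (z * deriv f z)"
  proof -
    have "(f z - f (-z)) * s z = 2 * (z * deriv f z)" if "z \<in> unit_disc" for z
    proof (cases "z = 0")
      case False
      \<comment> \<open>If \<open>f z = f (- z)\<close>, the quotient would take the default value
        \<open>0\<close>; as \<open>s z\<close> is nonzero this cannot happen, and the denominator
        may be cleared.\<close>
      have "s z \<noteq> 0" unfolding s_def using w(2) that by (intro csqrt_unit_disc) (auto simp: image_subset_iff)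
      moreover have "s z = 2 * z * deriv f z / (f z - f (- z))"
        using fw[OF that] False by (simp add: s_def sym_quot_def)
      ultimately show ?thesis by (auto simp: field_simps)
    qed simp
    then show ?thesis
      using eventually_nhds_in_open[of unit_disc 0] by (auto elim!: eventually_mono)
  qed
  from L[unfolded has_fps_expansion_cong[OF this refl]]
  have FQ: "2 * (fps_X * fps_deriv F) = (F - (F oo (fps_const (-1) * fps_X))) * Q"
    by (rule fps_expansion_unique_complex[OF R])
  define b d q where "b = fps_nth F" and "d = fps_nth W" and "q = fps_nth Q"
  have b: "b 0 = 0" "b (Suc 0) = 1" by (simp_all add: b_def F_def fps_expansion_def f)
  have q0: "q 0 = 1" by (simp add: q_def Q_def fps_expansion_def s_def w)
  have eq1: "fps_nth (2 * (fps_X * fps_deriv F)) n = fps_nth ((F - (F oo (fps_const (-1) * fps_X))) * Q) n"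
    and eq2: "fps_nth (Q ^ 2) n = fps_nth (1 + W) n" for n
    by (simp_all only: FQ QW)
  note S = fps_mult_nth numeral_fps_const eval_nat_numeral b q0 b_def[symmetric] d_def[symmetric] q_def[symmetric]
  \<comment> \<open>Only odd powers survive in \<open>f z - f (- z)\<close>, the lowest being
    \<open>2 * z\<close>; hence order \<open>n\<close> determines \<open>q (n - 1)\<close>, and
    order \<open>5\<close> is needed to reach \<open>q 4\<close>.\<close>
  have "2 * q 1 = 4 * b 2" using eq1[of 2] by (simp add: S)
  then have q1: "q 1 = 2 * b 2" by simp
  have "2 * q 2 + 2 * b 3 = 6 * b 3" using eq1[of 3] by (simp add: S)
  then have q2: "q 2 = 2 * b 3" by simp
  have "2 * q 3 + 2 * b 3 * q 1 = 8 * b 4" using eq1[of 4] by (simp add: S)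
  then have q3: "q 3 = 4 * b 4 - 2 * b 2 * b 3" unfolding q1 by algebra
  have "2 * q 4 + 2 * b 3 * q 2 + 2 * b 5 = 10 * b 5" using eq1[of 5] by (simp add: S)
  then have q4: "q 4 = 4 * b 5 - 2 * (b 3)\<^sup>2" unfolding q2 by algebra
  note q = q1 q2 q3 q4
  have d1: "d 1 = 2 * q 1" using eq2[of 1] by (simp add: S algebra_simps)
  have d2: "d 2 = 2 * q 2 + q 1 ^ 2" using eq2[of 2] by (simp add: S algebra_simps)
  have d3: "d 3 = 2 * q 3 + 2 * q 1 * q 2" using eq2[of 3] by (simp add: S algebra_simps)
  have d4: "d 4 = 2 * q 4 + 2 * q 1 * q 3 + q 2 ^ 2" using eq2[of 4] by (simp add: S algebra_simps)
  note d = d1 d2 d3 d4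
  have ac: "a n = b n" "c n = d n" for n
    by (simp_all add: a_def c_def taylor_coeff_eqI[OF F] taylor_coeff_eqI[OF W] b_def d_def)
  show "c 1 = 4 * a 2" "c 2 = 4 * a 3 + 4 * (a 2)\<^sup>2" "c 3 = 8 * a 4 + 4 * a 2 * a 3"
    "c 4 = 8 * a 5 + 16 * a 2 * a 4 - 8 * (a 2)\<^sup>2 * a 3"
    unfolding ac d q by (simp_all add: algebra_simps power2_eq_square)
qed

section \<open>The extremal function: existence and univalence\<close>

text \<open>The Noshiro-Warschawski criterion. Along the segment from \<open>a\<close> to
  \<open>b\<close>, the real part of \<open>f / (b - a)\<close> has derivative
  \<open>Re f' > 0\<close>, so it increases strictly and \<open>f a \<noteq> f b\<close>.\<close>

lemma inj_on_if_Re_deriv_pos: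
  assumes "convex S" and deriv: "\<And>z. z \<in> S \<Longrightarrow> (f has_field_derivative f' z) (at z)"
    and pos: "\<And>z. z \<in> S \<Longrightarrow> 0 < Re (f' z)"
  shows "inj_on f S"
proof (rule inj_onI, rule ccontr)
  fix a b assume ab: "a \<in> S" "b \<in> S" "f a = f b" "a \<noteq> b"
  define p where "p = (\<lambda>t::real. a + of_real t * (b - a))"
  define h where "h = (\<lambda>t. Re (f (p t) / (b - a)))"
  have "\<exists>y. (h has_real_derivative y) (at t) \<and> 0 < y" if "0 \<le> t" "t \<le> 1" for t
  proof (intro exI conjI)
    have pS: "p t \<in> S"
      using convexD[OF assms(1) ab(1,2), of "1 - t" t] that
      by (simp add: p_def scaleR_conv_of_real algebra_simps)
    have "(p has_vector_derivative (b - a)) (at t)"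
      unfolding p_def by (auto intro!: derivative_eq_intros)
    from field_vector_diff_chain_at[OF this deriv[OF pS]]
    have "((\<lambda>t. f (p t)) has_vector_derivative (b - a) * f' (p t)) (at t)"
      by (simp add: o_def)
    from has_vector_derivative_mult_left[OF this, of "1 / (b - a)"]
    have "((\<lambda>t. f (p t) / (b - a)) has_vector_derivative f' (p t)) (at t)"
      using ab by simp
    then show "(h has_real_derivative Re (f' (p t))) (at t)"
      unfolding h_def has_real_derivative_iff_has_vector_derivative
      by (rule bounded_linear.has_vector_derivative[OF bounded_linear_Re])
    show "0 < Re (f' (p t))" by (rule pos[OF pS])
  qed
  from DERIV_pos_imp_increasing[OF zero_less_one this] have "h 0 < h 1" by simp
  then show False using ab by (simp add: h_def p_def)
qed

text \<open>The normalised solution of \<open>z * g' = g * sqrt (1 + z\<^sup>2)\<close>. The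
  explicit factor \<open>z\<close> exhibits oddness and the single zero, and avoids a logarithm at
  the origin.\<close>

definition g1 :: "complex \<Rightarrow> complex" where
  "g1 z = z * (2 * exp (csqrt (1 + z\<^sup>2) - 1) / (1 + csqrt (1 + z\<^sup>2)))"

lemma square_unit_disc: "z \<in> unit_disc \<Longrightarrow> z\<^sup>2 \<in> unit_disc"
  by (simp add: norm_power power_less_one_iff abs_square_less_1)

lemma one_plus_csqrt_nonpos:
  assumes "z \<in> unit_disc" shows "1 + csqrt (1 + z\<^sup>2) \<notin> \<real>\<^sub>\<le>\<^sub>0"
  using csqrt_unit_disc(3)[OF square_unit_disc[OF assms]]
  by (auto simp: complex_nonpos_Reals_iff simp del: csqrt.sel)

lemma one_plus_csqrt_nz: "z \<in> unit_disc \<Longrightarrow> 1 + csqrt (1 + z\<^sup>2) \<noteq> 0"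
  using one_plus_csqrt_nonpos by fastforce

lemma csqrt_square_deriv:
  assumes "z \<in> unit_disc"
  shows "((\<lambda>z. csqrt (1 + z\<^sup>2)) has_field_derivative z / csqrt (1 + z\<^sup>2)) (at z)"
  using csqrt_unit_disc[OF square_unit_disc[OF assms]]
  by (auto intro!: derivative_eq_intros)

lemma g1_deriv:
  assumes z: "z \<in> unit_disc"
  shows "(g1 has_field_derivative 2 * exp (csqrt (1 + z\<^sup>2) - 1) / (1 + csqrt (1 + z\<^sup>2)) * csqrt (1 + z\<^sup>2)) (at z)"
proof -
  define S where "S = (\<lambda>z::complex. csqrt (1 + z\<^sup>2))"
  have S: "S z \<noteq> 0" "1 + S z \<noteq> 0" "z * z = S z * S z - 1"
    using csqrt_unit_disc[OF square_unit_disc[OF z]] one_plus_csqrt_nz[OF z] power2_csqrt[of "1 + z\<^sup>2"]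
    by (auto simp: S_def power2_eq_square)
  have S': "(S has_field_derivative z / S z) (at z)"
    unfolding S_def by (rule csqrt_square_deriv[OF z])
  have "((\<lambda>z. z * (2 * exp (S z - 1) / (1 + S z))) has_field_derivative
      2 * exp (S z - 1) / (1 + S z) * (1 + z * z / (1 + S z))) (at z)"
    using S(1,2) by (auto intro!: derivative_eq_intros S') (simp add: divide_simps, simp add: algebra_simps)
  \<comment> \<open>Here \<open>z * z = (S z - 1) * (S z + 1)\<close>, so the fraction equals
    \<open>S z - 1\<close>.\<close>
  also have "1 + z * z / (1 + S z) = S z"
    unfolding S(3) using S(2) by (simp add: field_simps)
  finally show ?thesis by (simp add: S_def g1_def[abs_def])
qed

lemma g1_holomorphic: "g1 holomorphic_on unit_disc"
  using g1_deriv holomorphic_on_open by blast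

lemma g1_0: "g1 0 = 0" "deriv g1 0 = 1"
  using DERIV_imp_deriv[OF g1_deriv[of 0]] by (simp_all add: g1_def)

lemma g1_eq_0_iff: "z \<in> unit_disc \<Longrightarrow> g1 z = 0 \<longleftrightarrow> z = 0"
  using one_plus_csqrt_nz by (auto simp: g1_def)

lemma z_deriv_g1: "z \<in> unit_disc \<Longrightarrow> z * deriv g1 z = g1 z * csqrt (1 + z\<^sup>2)"
  using DERIV_imp_deriv[OF g1_deriv] by (simp add: g1_def)

lemma is_g1_g1: "is_g1 g1"
proof -
  have "sym_quot g1 z = csqrt (1 + z\<^sup>2)" if z: "z \<in> unit_disc" for z
  proof (cases "z = 0")
    case False
    \<comment> \<open>Oddness turns the denominator of the symmetric quotient into
      \<open>2 * g1 z\<close>.\<close>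
    have "g1 (- z) = - g1 z" by (simp add: g1_def)
    then show ?thesis
      using False z_deriv_g1[OF z] g1_eq_0_iff[OF z] by (simp add: sym_quot_def mult.assoc)
  qed (simp add: sym_quot_def)
  then show ?thesis
    using g1_holomorphic g1_0 by (simp add: is_g1_def)
qed

text \<open>
  In the coordinate \<open>\<zeta> = log z\<close> the function \<open>log g1\<close> has derivative \<open>z g1' / g1\<close>, which has
  positive real part on the half plane \<open>Re \<zeta> < 0\<close>.
\<close>

lemma inj_on_g1: "inj_on g1 unit_disc"
proof -
  define H where "H = {\<zeta>. Re \<zeta> < 0}"
  define s where "s = (\<lambda>\<zeta>. csqrt (1 + (exp \<zeta>)\<^sup>2))"
  define G where "G = (\<lambda>\<zeta>. \<zeta> + s \<zeta> - 1 - Ln ((1 + s \<zeta>) / 2))"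
  have disc: "exp \<zeta> \<in> unit_disc" if "\<zeta> \<in> H" for \<zeta>
    using that by (simp add: H_def)
  have s_deriv: "(s has_field_derivative (exp \<zeta>)\<^sup>2 / s \<zeta>) (at \<zeta>)" if "\<zeta> \<in> H" for \<zeta>
    unfolding s_def using DERIV_chain2[OF csqrt_square_deriv[OF disc[OF that]] DERIV_exp[of \<zeta>]]
    by (simp add: power2_eq_square)
  have G_deriv: "(G has_field_derivative s \<zeta>) (at \<zeta>)" if "\<zeta> \<in> H" for \<zeta>
  proof -
    have nz: "s \<zeta> \<noteq> 0" "1 + s \<zeta> \<noteq> 0" and sq: "(exp \<zeta>)\<^sup>2 = s \<zeta> * s \<zeta> - 1"
      using csqrt_unit_disc(2)[OF square_unit_disc[OF disc[OF that]]] one_plus_csqrt_nz[OF disc[OF that]]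
        power2_csqrt[of "1 + (exp \<zeta>)\<^sup>2"] by (auto simp: s_def power2_eq_square)
    have "(1 + s \<zeta>) / 2 \<notin> \<real>\<^sub>\<le>\<^sub>0"
      using one_plus_csqrt_nonpos[OF disc[OF that]] by (auto simp: s_def complex_nonpos_Reals_iff)
    then have "(G has_field_derivative (1 + (exp \<zeta>)\<^sup>2 / s \<zeta> - (exp \<zeta>)\<^sup>2 / s \<zeta> / 2 / ((1 + s \<zeta>) / 2))) (at \<zeta>)"
      unfolding G_def by (auto intro!: derivative_eq_intros s_deriv[OF that])
    also have "1 + (exp \<zeta>)\<^sup>2 / s \<zeta> - (exp \<zeta>)\<^sup>2 / s \<zeta> / 2 / ((1 + s \<zeta>) / 2) = s \<zeta>"
      unfolding sq using nz by (simp add: divide_simps) (simp add: algebra_simps)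
    finally show ?thesis .
  qed
  have "0 < Re (s \<zeta>)" if "\<zeta> \<in> H" for \<zeta>
    unfolding s_def by (intro csqrt_unit_disc(3) square_unit_disc disc that)
  moreover have "convex H"
    unfolding H_def using convex_halfspace_Re_lt by blast
  ultimately have inj: "inj_on G H"
    using G_deriv by (intro inj_on_if_Re_deriv_pos)
  have exp_G: "exp (G \<zeta>) = g1 (exp \<zeta>)" if "\<zeta> \<in> H" for \<zeta>
    using one_plus_csqrt_nz[OF disc[OF that]]
    by (simp add: G_def g1_def s_def exp_add exp_diff)
  have H_iff: "Ln z \<in> H" if "z \<in> unit_disc" "z \<noteq> 0" for z
    using that by (simp add: H_def)
  have main: "z = w" if z: "z \<in> unit_disc" "z \<noteq> 0" and w: "w \<in> unit_disc" "w \<noteq> 0" and eq: "g1 z = g1 w" for z w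
  proof -
    have "exp (G (Ln z)) = exp (G (Ln w))"
      using exp_G[OF H_iff[OF z]] exp_G[OF H_iff[OF w]] eq z w by simp
    then obtain n :: int where n: "G (Ln z) = G (Ln w) + of_int (2 * n) * pi * \<i>"
      unfolding exp_eq by auto
    \<comment> \<open>As \<open>s\<close> depends on \<open>exp \<zeta>\<close> only,
      \<open>G\<close> commutes with translations by multiples of \<open>2 * pi * \<i>\<close>. The
      ambiguity of the logarithm thus moves into the argument, which stays in
      \<open>H\<close>.\<close>
    define \<zeta> where "\<zeta> = Ln w + of_int (2 * n) * pi * \<i>"
    have \<zeta>: "\<zeta> \<in> H" "exp \<zeta> = exp (Ln w)"
      using H_iff[OF w] by (auto simp: \<zeta>_def H_def exp_eq)
    have "G \<zeta> = G (Ln w) + of_int (2 * n) * pi * \<i>"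
      unfolding G_def s_def \<zeta>(2) by (simp add: \<zeta>_def)
    with n inj \<zeta>(1) H_iff[OF z] have "Ln z = \<zeta>" by (simp add: inj_on_def)
    then show "z = w" using z w \<zeta>(2) by (metis exp_Ln)
  qed
  show ?thesis
  proof (rule inj_onI)
    fix z w assume zw: "z \<in> unit_disc" "w \<in> unit_disc" "g1 z = g1 w"
    show "z = w"
    proof (cases "z = 0 \<or> w = 0")
      case True
      then show ?thesis using g1_eq_0_iff[OF zw(1)] g1_eq_0_iff[OF zw(2)] zw(3) by auto
    next
      case False
      then show ?thesis using main zw by blast
    qed
  qed
qed

section \<open>Uniqueness of the extremal function\<close>

text \<open>Any solution is odd, which reduces the equation relating \<open>g z\<close> and
  \<open>g (- z)\<close> to \<open>z * g' = g * sqrt (1 + z\<^sup>2)\<close>. Both \<open>g\<close>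
  and \<open>g1\<close> satisfy it, so their quotient is constant, and the normalisation makes the
  constant \<open>1\<close>.\<close>

lemma is_g1_unique:
  assumes "is_g1 g" and z: "z \<in> unit_disc"
  shows "g z = g1 z"
proof -
  have g: "g holomorphic_on unit_disc" "g 0 = 0" "deriv g 0 = 1"
    and quot: "\<And>z. z \<in> unit_disc \<Longrightarrow> sym_quot g z = csqrt (1 + z\<^sup>2)"
    using assms(1) by (auto simp: is_g1_def)
  have D: "(g has_field_derivative deriv g z) (at z)" if "z \<in> unit_disc" for z
    using g(1) that by (intro holomorphic_derivI[OF _ open_ball])
  have ode: "2 * (z * deriv g z) = (g z - g (- z)) * csqrt (1 + z\<^sup>2)" if "z \<in> unit_disc" for z
  proof (cases "z = 0")
    case False
    have "csqrt (1 + z\<^sup>2) = 2 * z * deriv g z / (g z - g (- z))"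
      using quot[OF that] False by (simp add: sym_quot_def)
    with csqrt_unit_disc(2)[OF square_unit_disc[OF that]] show ?thesis
      by (auto simp: field_simps)
  qed (simp add: g)
  \<comment> \<open>Replacing \<open>z\<close> by \<open>- z\<close> flips the sign of the right
    side of \<open>ode\<close>. Hence \<open>g'\<close> is even, the even part of \<open>g\<close>
    is constant, and it vanishes with \<open>g 0\<close>.\<close>
  have even: "deriv g (- z) = deriv g z" if "z \<in> unit_disc" for z
  proof (cases "z = 0")
    case False
    have "2 * (- z * deriv g (- z)) = (g (- z) - g z) * csqrt (1 + z\<^sup>2)"
      using ode[of "- z"] that by simp
    also have "\<dots> = - ((g z - g (- z)) * csqrt (1 + z\<^sup>2))"
      by (simp add: algebra_simps)
    also have "\<dots> = - (2 * (z * deriv g z))"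
      by (simp only: ode[OF that])
    finally have "z * deriv g (- z) = z * deriv g z" by simp
    then show ?thesis using False by auto
  qed simp
  have "((\<lambda>z. g z + g (- z)) has_field_derivative 0) (at z within unit_disc)" if "z \<in> unit_disc" for z
  proof -
    have "((\<lambda>z. g (- z)) has_field_derivative deriv g (- z) * (- 1)) (at z)"
      using that by (intro DERIV_chain2[of g]) (auto intro!: D derivative_eq_intros)
    from DERIV_add[OF D[OF that] this] show ?thesis
      using even[OF that] by (simp add: has_field_derivative_at_within)
  qed
  from has_field_derivative_zero_constant[OF convex_ball this]
  obtain c where c: "\<And>z. z \<in> unit_disc \<Longrightarrow> g z + g (- z) = c" by blast
  have "c = 0" using c[of 0] g by simp
  have g_ode: "z * deriv g z = g z * csqrt (1 + z\<^sup>2)" if "z \<in> unit_disc" for z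
  proof -
    have "g (- z) = - g z"
      using c[OF that] \<open>c = 0\<close> by (simp add: add_eq_0_iff)
    with ode[OF that] show ?thesis by simp
  qed
  have "((\<lambda>z. g z / g1 z) has_field_derivative 0) (at z)" if "z \<in> unit_disc - {0}" for z
  proof -
    have z: "z \<in> unit_disc" "z \<noteq> 0" "g1 z \<noteq> 0" using that g1_eq_0_iff[of z] by auto
    have "(g1 has_field_derivative deriv g1 z) (at z)"
      using g1_holomorphic z(1) by (intro holomorphic_derivI[OF _ open_ball])
    from DERIV_divide[OF D[OF z(1)] this z(3)]
    have "((\<lambda>z. g z / g1 z) has_field_derivative (deriv g z * g1 z - g z * deriv g1 z) / (g1 z * g1 z)) (at z)" .
    moreover have "z * (deriv g z * g1 z - g z * deriv g1 z) = (z * deriv g z) * g1 z - g z * (z * deriv g1 z)"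
      by (simp add: algebra_simps)
    then have "deriv g z * g1 z - g z * deriv g1 z = 0"
      unfolding g_ode[OF z(1)] z_deriv_g1[OF z(1)] using z(2) by (simp add: mult_ac)
    ultimately show ?thesis by simp
  qed
  then have D0: "\<forall>z\<in>unit_disc - {0} - {}. ((\<lambda>z. g z / g1 z) has_field_derivative 0) (at z)"
    by blast
  then have "continuous_on (unit_disc - {0}) (\<lambda>z. g z / g1 z)"
    by (intro continuous_at_imp_continuous_on ballI DERIV_isCont) auto
  moreover have "connected (unit_disc - {0})"
    by (intro connected_open_delete) auto
  ultimately obtain k where k: "\<And>z. z \<in> unit_disc - {0} \<Longrightarrow> g z / g1 z = k"
    using DERIV_zero_connected_constant[OF _ _ finite.emptyI _ D0] by blast
  have gk: "g z = k * g1 z" if "z \<in> unit_disc" for z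
    using k[of z] that g1_eq_0_iff[OF that] g g1_0 by (cases "z = 0") (auto simp: field_simps)
  have "deriv g 0 = deriv (\<lambda>z. k * g1 z) 0"
    by (rule deriv_cong_ev) (use gk eventually_nhds_in_open[of unit_disc 0] in \<open>auto elim!: eventually_mono\<close>)
  also have "\<dots> = k * deriv g1 0"
    using g1_holomorphic by (intro deriv_cmult holomorphic_on_imp_differentiable_at[OF _ open_ball]) auto
  finally have "k = 1" using g g1_0 by simp
  then show ?thesis using gk z by simp
qed

section \<open>The bound and its sharpness\<close>

text \<open>Serves both halves: a general \<open>w\<close> for the bound, and
  \<open>w z = z\<^sup>2\<close> for equality.\<close>

lemma H23_difference:
  assumes f: "f \<in> class_S"
    and w: "w holomorphic_on unit_disc" "w ` unit_disc \<subseteq> unit_disc" "w 0 = 0"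
    and fw: "\<And>z. z \<in> unit_disc \<Longrightarrow> sym_quot f z = csqrt (1 + w z)"
  defines "c \<equiv> taylor_coeff w"
  defines "e \<equiv> c 2 - (c 1)\<^sup>2 / 4"
  shows "64 * (H23 (disc_inverse f) - H23 f) =
    - (3 * e^3) + 2 * c 1 * e * c 3 - (c 1)\<^sup>2 * c 4 + 3/4 * c 1 ^ 3 * c 3
    - 11/16 * c 1 ^ 4 * e + 3/64 * c 1 ^ 6"
proof -
  have "f holomorphic_on unit_disc" "f 0 = 0" "deriv f 0 = 1"
    using f by (auto simp: class_S_def)
  note coeffs = sym_quot_coeffs[OF this w fw, folded c_def]
  show ?thesis
    unfolding H23_def
    by (rule hankel_difference_identity[OF coeffs inverse_coeffs[OF f]]) (simp_all add: e_def)
qed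

lemma class_SSL_bound:
  assumes "f \<in> class_SSL"
  shows "cmod (H23 (disc_inverse f) - H23 f) \<le> 3 / 64"
proof -
  obtain w where f: "f \<in> class_S"
    and w: "w holomorphic_on unit_disc" "w ` unit_disc \<subseteq> unit_disc" "w 0 = 0"
    and fw: "\<And>z. z \<in> unit_disc \<Longrightarrow> sym_quot f z = csqrt (1 + w z)"
    using assms by (auto simp: class_SSL_def subordinate_def)
  have "cmod (w z) \<le> 1" if "z \<in> unit_disc" for z
    using w(2) that by (force simp: image_subset_iff)
  \<comment> \<open>The constant term vanishes, so the Bessel sum starts at
    \<open>c 1\<close>.\<close>
  moreover have c0: "taylor_coeff w 0 = 0" by (simp add: taylor_coeff_def fps_expansion_def w)
  ultimately have "(cmod (taylor_coeff w 1))\<^sup>2 + (cmod (taylor_coeff w 2))\<^sup>2 + (cmod (taylor_coeff w 3))\<^sup>2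
      + (cmod (taylor_coeff w 4))\<^sup>2 \<le> 1"
    using bessel_unit_disc[OF w(1), of 4] by (simp add: eval_nat_numeral)
  from norm_hankel_difference_le_3[OF this refl]
  have "cmod (64 * (H23 (disc_inverse f) - H23 f)) \<le> 3"
    by (simp only: H23_difference[OF f w fw])
  then show ?thesis by (simp only: norm_mult) simp
qed

lemma taylor_coeff_square: "taylor_coeff (\<lambda>z. z\<^sup>2) n = (if n = 2 then 1 else 0)"
  using taylor_coeff_eqI[OF has_fps_expansion_fps_X_power[of 2]] by simp

lemma is_g1_extremal:
  assumes g: "is_g1 g"
  shows "g \<in> class_SSL" and "taylor_coeff g 2 = 0" and "taylor_coeff g 3 = 1 / 4"
    and "cmod (H23 (disc_inverse g) - H23 g) = 3 / 64"
proof -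
  have hol: "g holomorphic_on unit_disc" "g 0 = 0" "deriv g 0 = 1"
    and quot: "\<And>z. z \<in> unit_disc \<Longrightarrow> sym_quot g z = csqrt (1 + z\<^sup>2)"
    using g by (auto simp: is_g1_def)
  have "inj_on g unit_disc"
    using inj_on_g1 inj_on_cong[of unit_disc g g1] is_g1_unique[OF g] by blast
  then have S: "g \<in> class_S" using hol by (simp add: class_S_def)
  have w: "(\<lambda>z. z\<^sup>2) holomorphic_on unit_disc" "(\<lambda>z. z\<^sup>2) ` unit_disc \<subseteq> unit_disc" "(0::complex)\<^sup>2 = 0"
    using square_unit_disc by (auto intro!: holomorphic_intros simp del: mem_ball)
  show "g \<in> class_SSL"
    using S w quot unfolding class_SSL_def subordinate_def by blast
  have "0 = 4 * taylor_coeff g 2" "1 = 4 * taylor_coeff g 3 + 4 * (taylor_coeff g 2)\<^sup>2"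
    using sym_quot_coeffs(1,2)[OF hol w quot] by (simp_all add: taylor_coeff_square)
  then show "taylor_coeff g 2 = 0" "taylor_coeff g 3 = 1 / 4" by (simp_all add: field_simps)
  \<comment> \<open>For \<open>w z = z\<^sup>2\<close> only \<open>c 2 = 1\<close> is nonzero, so
    \<open>e = 1\<close> and all terms but \<open>- (3 * e^3)\<close> vanish.\<close>
  have "64 * (H23 (disc_inverse g) - H23 g) = - 3"
    using H23_difference[OF S w quot] by (simp add: taylor_coeff_square)
  then have "cmod (64 * (H23 (disc_inverse g) - H23 g)) = 3" by simp
  then show "cmod (H23 (disc_inverse g) - H23 g) = 3 / 64" by (simp only: norm_mult) simp
qed

text \<open>The existence conjunct keeps the sharpness claim from being vacuous. Sharpness is stated
  for every \<open>g\<close> with \<open>is_g1 g\<close>, as the values off the disc are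
  arbitrary.\<close>

theorem corollary2p15:
  shows "(\<forall>f\<in>class_SSL. cmod (H23 (disc_inverse f) - H23 f) \<le> 3 / 64) \<and>
         (\<exists>g. is_g1 g) \<and>
         (\<forall>g. is_g1 g \<longrightarrow>
            g \<in> class_SSL \<and> taylor_coeff g 2 = 0 \<and> taylor_coeff g 3 = 1 / 4 \<and>
            cmod (H23 (disc_inverse g) - H23 g) = 3 / 64)"
  using class_SSL_bound is_g1_g1 is_g1_extremal by blast

end
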